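(* Let $D$ be a digraph such that $\vec{\chi}(D)\le 3$. Then $D$ is majority $3$-colorable.
   Context: Digraphs are finite, loopless, have no parallel edges, but may have anti-parallel pairs of edges (digons; a digon is a directed cycle of length $2$). $N^+(v)$ denotes the set of out-neighbors of $v$. The dichromatic number $\vec{\chi}(D)$ is the smallest $k$ for which there is a partition $X_1,\dots,X_k$ of $V(D)$ such that each induced subdigraph $D[X_i]$ is acyclic (contains no directed cycle). A majority coloring of $D$ with $k$ colors is a map $c:V(D)\to\{1,\dots,k\}$ such that for every $v\in V(D)$, at most half of the out-neighbors $w\in N^+(v)$ satisfy $c(w)=c(v)$. $D$ is majority $k$-colorable if it has a majority coloring with $k$ colors. *)

theory Defs
  imports
    "Graph_Theory.Graph_Theory"
    "HOL-Library.Disjoint_Sets"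
    "HOL-Library.FuncSet"
begin

definition out_neighbors :: "('a, 'b) pre_digraph \<Rightarrow> 'a \<Rightarrow> 'a set" where
  "out_neighbors D v = {w. v \<rightarrow>\<^bsub>D\<^esub> w}"

definition acyclic_digraph :: "('a, 'b) pre_digraph \<Rightarrow> bool" where
  "acyclic_digraph D \<longleftrightarrow> (\<nexists>p. pre_digraph.cycle D p)"

(* The parts are nonempty by partition_on; this does not affect the minimum k. *)
definition acyclic_partition :: "('a, 'b) pre_digraph \<Rightarrow> nat \<Rightarrow> bool" where
  "acyclic_partition D k \<longleftrightarrow>
     (\<exists>P. partition_on (verts D) P \<and> finite P \<and> card P = k \<and>
          (\<forall>X\<in>P. acyclic_digraph (D \<restriction> X)))"

definition dichromatic_number :: "('a, 'b) pre_digraph \<Rightarrow> nat" where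
  "dichromatic_number D = (LEAST k. acyclic_partition D k)"

definition majority_coloring :: "('a, 'b) pre_digraph \<Rightarrow> nat \<Rightarrow> ('a \<Rightarrow> nat) \<Rightarrow> bool" where
  "majority_coloring D k c \<longleftrightarrow>
     c \<in> verts D \<rightarrow> {1..k} \<and>
     (\<forall>v\<in>verts D. 2 * card {w \<in> out_neighbors D v. c w = c v} \<le> card (out_neighbors D v))"

definition majority_colorable :: "('a, 'b) pre_digraph \<Rightarrow> nat \<Rightarrow> bool" where
  "majority_colorable D k \<longleftrightarrow> (\<exists>c. majority_coloring D k c)"

(* The minimum in dichromatic_number is attained: partition into singletons. *)
lemma (in digraph) acyclic_partition_dichromatic_number:
  "acyclic_partition G (dichromatic_number G)"
proof -
  have acyc: "acyclic_digraph (G \<restriction> {v})" for v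
    unfolding acyclic_digraph_def
  proof
    assume "\<exists>p. pre_digraph.cycle (G \<restriction> {v}) p"
    then obtain p u where p: "pre_digraph.awalk (G \<restriction> {v}) u p u" "p \<noteq> []"
      unfolding pre_digraph.cycle_def by blast
    then obtain e where "e \<in> arcs (G \<restriction> {v})"
      unfolding pre_digraph.awalk_def by (cases p) auto
    then show False using no_loops[of e] by auto
  qed
  have "partition_on (verts G) ((\<lambda>v. {v}) ` verts G)"
    by (rule partition_onI) auto
  with acyc have "acyclic_partition G (card ((\<lambda>v. {v}) ` verts G))"
    unfolding acyclic_partition_def by (intro exI[of _ "(\<lambda>v. {v}) ` verts G"]) auto
  then show ?thesis
    unfolding dichromatic_number_def by (rule LeastI)
qed

end

theory Submission
  imports Defs
begin

text \<open>
  Split the vertices into acyclic, possibly empty classes \<open>X\<^sub>0, X\<^sub>1, X\<^sub>2\<close>, let the colors be \<open>1, 2, 3\<close>, and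
  allow a vertex of \<open>X\<^sub>i\<close> only two of them: \<open>i + 1\<close> and its cyclic successor. Then
  each of the two colors of \<open>X\<^sub>i\<close> is shared with exactly one other class, and these two classes
  are different.

  Fix \<open>v\<close> in \<open>X\<^sub>i\<close>, and suppose that its out-neighbors inside \<open>X\<^sub>i\<close> already have their colors. Even
  in the worst case, where every out-neighbor in another class takes the color that this class
  shares with \<open>X\<^sub>i\<close>, an out-neighbor of \<open>v\<close> obstructs at most one of the two colors allowed
  at \<open>v\<close>. So the two worst-case counts add up to at most the out-degree of \<open>v\<close>, and
  one of them is at most half of it. Choosing that color is safe whatever the other
  classes do. The choice therefore depends only on the out-neighbors in the same
  class, and as the class is acyclic, the choices can be made recursively, sinks first, and
  independently in the three classes. The recursion is lemma \<open>two_coloring_with_reserved_neighbors\<close>.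
\<close>

text \<open>
  Think of \<open>p v\<close> and \<open>q v\<close> as the numbers of further out-neighbors of \<open>v\<close> that are counted in advance
  against \<open>a\<close> and \<open>b\<close>, respectively. Once \<open>N v\<close> is colored, each out-neighbor counts against at most
  one of the two colors, so the two counts cannot both exceed half of \<open>d v\<close>. Well-foundedness
  makes this choice a recursive definition of the coloring.
\<close>
lemma two_coloring_with_reserved_neighbors:
  fixes N :: "'a \<Rightarrow> 'a set" and p q d :: "'a \<Rightarrow> nat" and a b :: 'c
  assumes wf: "wf {(w, v). w \<in> N v}"
    and fin: "\<And>v. finite (N v)"
    and "a \<noteq> b"
    and deg: "\<And>v. card (N v) + p v + q v \<le> d v"
  obtains c where
    "\<And>v. c v = a \<and> 2 * (card {w \<in> N v. c w = a} + p v) \<le> d v \<or>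
         c v = b \<and> 2 * (card {w \<in> N v. c w = b} + q v) \<le> d v"
proof -
  define ok where "ok c v x \<longleftrightarrow>
      x = a \<and> 2 * (card {w \<in> N v. c w = a} + p v) \<le> d v \<or>
      x = b \<and> 2 * (card {w \<in> N v. c w = b} + q v) \<le> d v" for c v x
  have "\<exists>c. \<forall>v. ok c v (c v)"
  proof (rule dependent_wf_choice[OF wf])
    fix c c' :: "'a \<Rightarrow> 'c" and v x
    assume "\<And>z. (z, v) \<in> {(w, v). w \<in> N v} \<Longrightarrow> c z = c' z"
    then have "{w \<in> N v. c w = y} = {w \<in> N v. c' w = y}" for y
      by auto
    then show "ok c v x = ok c' v x"
      unfolding ok_def by simp
  next
    fix v and c :: "'a \<Rightarrow> 'c"
    have "card {w \<in> N v. c w = a} + card {w \<in> N v. c w = b}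
        = card ({w \<in> N v. c w = a} \<union> {w \<in> N v. c w = b})"
      using \<open>a \<noteq> b\<close> fin[of v] by (intro card_Un_disjoint[symmetric]) auto
    also have "\<dots> \<le> card (N v)"
      using fin[of v] by (intro card_mono) auto
    finally have "2 * (card {w \<in> N v. c w = a} + p v) \<le> d v \<or>
        2 * (card {w \<in> N v. c w = b} + q v) \<le> d v"
      using deg[of v] by arith
    then show "\<exists>x. ok c v x"
      unfolding ok_def by blast
  qed
  then show thesis
    using that unfolding ok_def by blast
qed

lemma (in fin_digraph) wf_dominated_if_acyclic:
  assumes "acyclic_digraph G"
  shows "wf {(w, v). v \<rightarrow> w}"
proof -
  have "acyclic (arcs_ends G)"
  proof (rule acyclicI, rule allI, rule notI)
    fix v
    assume "v \<rightarrow>\<^sup>+ v"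
    then have "\<exists>p. closed_w p"
      unfolding reachable1_awalk closed_w_def by auto
    then show False
      using closed_w_imp_cycle assms unfolding acyclic_digraph_def by blast
  qed
  moreover have "finite (arcs_ends G)"
    unfolding arcs_ends_def by simp
  ultimately have "wf ((arcs_ends G)\<inverse>)"
    by (rule finite_acyclic_wf_converse[rotated])
  then show ?thesis
    by (simp add: converse_unfold)
qed

lemma acyclic_classes_if_acyclic_partition:
  assumes "acyclic_partition D k"
  obtains f where "\<And>v. v \<in> verts D \<Longrightarrow> f v < k"
    and "\<And>i. i < k \<Longrightarrow> acyclic_digraph (D \<restriction> {v \<in> verts D. f v = i})"
proof -
  obtain P where P: "partition_on (verts D) P" "finite P" "card P = k"
    and acyc: "\<And>X. X \<in> P \<Longrightarrow> acyclic_digraph (D \<restriction> X)"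
    using assms unfolding acyclic_partition_def by blast
  obtain h where h: "bij_betw h {0..<k} P"
    using ex_bij_betw_nat_finite[OF \<open>finite P\<close>] P(3) by blast
  have "\<forall>v\<in>verts D. \<exists>i<k. v \<in> h i"
    using partition_onD1[OF P(1)] bij_betw_imp_surj_on[OF h] by fastforce
  then obtain f where f: "\<And>v. v \<in> verts D \<Longrightarrow> f v < k \<and> v \<in> h (f v)"
    by metis
  have "{v \<in> verts D. f v = i} = h i" if "i < k" for i
  proof
    show "h i \<subseteq> {v \<in> verts D. f v = i}"
    proof
      fix v
      assume v: "v \<in> h i"
      have hi: "h i \<in> P"
        using bij_betwE[OF h] that by auto
      with v have v': "v \<in> verts D"
        using partition_onD1[OF P(1)] by auto
      then have "h (f v) \<in> P"
        using bij_betwE[OF h] f by auto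
      then have "h (f v) = h i"
        using partition_onD2[OF P(1)] hi v f[OF v'] unfolding disjoint_def by blast
      then have "f v = i"
        using bij_betw_imp_inj_on[OF h] f[OF v'] that by (auto dest: inj_onD)
      with v' show "v \<in> {v \<in> verts D. f v = i}"
        by simp
    qed
  qed (use f in auto)
  moreover have "h i \<in> P" if "i < k" for i
    using bij_betwE[OF h] that by auto
  ultimately show thesis
    using that[of f] f acyc by simp
qed

lemma (in fin_digraph) finite_out_neighbors: "finite (out_neighbors G v)"
  by (rule finite_subset[of _ "verts G"]) (auto simp: out_neighbors_def)

text \<open>
  Here \<open>A\<close> stands for the vertices outside of \<open>X\<close> that might take color \<open>a\<close>, and \<open>B\<close> for those that
  might take color \<open>b\<close>. Counting all of them as if they did makes the majority condition on \<open>X\<close>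
  hold for every coloring of the other vertices that uses \<open>a\<close> only on \<open>A\<close> and \<open>b\<close> only on \<open>B\<close>, so
  that \<open>X\<close> can be colored on its own.
\<close>
lemma (in fin_digraph) robust_coloring_of_acyclic_set:
  fixes a b :: 'c
  assumes "acyclic_digraph (G \<restriction> X)" "X \<subseteq> verts G"
    and "X \<inter> A = {}" "X \<inter> B = {}" "A \<inter> B = {}" "a \<noteq> b"
  shows "\<exists>c. \<forall>v\<in>X.
      c v = a \<and> 2 * card {w \<in> out_neighbors G v. w \<in> X \<and> c w = a \<or> w \<in> A}
        \<le> card (out_neighbors G v) \<or>
      c v = b \<and> 2 * card {w \<in> out_neighbors G v. w \<in> X \<and> c w = b \<or> w \<in> B}
        \<le> card (out_neighbors G v)"
proof -
  interpret H: fin_digraph "G \<restriction> X"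
    by unfold_locales (use finite_subset[OF assms(2)] wellformed in auto)
  let ?O = "out_neighbors G"
  let ?N = "\<lambda>v. ?O v \<inter> {w \<in> X. v \<in> X}"
  have fin: "finite (?O v)" for v
    by (rule finite_out_neighbors)
  have "w \<in> ?N v \<longleftrightarrow> v \<rightarrow>\<^bsub>G \<restriction> X\<^esub> w" for v w
    by (auto simp: out_neighbors_def arcs_ends_def arc_to_ends_def)
  then have "wf {(w, v). w \<in> ?N v}"
    using H.wf_dominated_if_acyclic[OF assms(1)] by simp
  moreover have "card (?N v) + card (?O v \<inter> A) + card (?O v \<inter> B) \<le> card (?O v)" for v
  proof -
    have "card (?N v) + card (?O v \<inter> A) + card (?O v \<inter> B)
        = card (?N v \<union> (?O v \<inter> A) \<union> (?O v \<inter> B))"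
      using fin[of v] assms(3-5) by (subst card_Un_disjoint; (subst card_Un_disjoint)?) auto
    also have "\<dots> \<le> card (?O v)"
      using fin[of v] by (intro card_mono) auto
    finally show ?thesis .
  qed
  ultimately obtain c where c: "\<And>v.
      c v = a \<and> 2 * (card {w \<in> ?N v. c w = a} + card (?O v \<inter> A)) \<le> card (?O v) \<or>
      c v = b \<and> 2 * (card {w \<in> ?N v. c w = b} + card (?O v \<inter> B)) \<le> card (?O v)"
    using two_coloring_with_reserved_neighbors[where N = ?N and a = a and b = b
        and p = "\<lambda>v. card (?O v \<inter> A)" and q = "\<lambda>v. card (?O v \<inter> B)" and d = "\<lambda>v. card (?O v)"]
      fin \<open>a \<noteq> b\<close>
    by (auto simp del: Int_iff)
  have bound: "2 * card {w \<in> ?O v. w \<in> X \<and> c w = x \<or> w \<in> Y} \<le> card (?O v)"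
    if "v \<in> X" and le: "2 * (card {w \<in> ?N v. c w = x} + card (?O v \<inter> Y)) \<le> card (?O v)" for v x Y
  proof -
    have "{w \<in> ?O v. w \<in> X \<and> c w = x \<or> w \<in> Y} = {w \<in> ?N v. c w = x} \<union> (?O v \<inter> Y)"
      using that(1) by auto
    then have "card {w \<in> ?O v. w \<in> X \<and> c w = x \<or> w \<in> Y}
        \<le> card {w \<in> ?N v. c w = x} + card (?O v \<inter> Y)"
      by (simp only: card_Un_le)
    then show ?thesis
      by (rule order_trans[OF mult_le_mono2 le])
  qed
  show ?thesis
    using c bound by (intro exI[of _ c] ballI) blast
qed

theorem theorem2:
  fixes D :: "('a, 'b) pre_digraph"
  assumes "digraph D"
    and "dichromatic_number D \<le> 3"
  shows "majority_colorable D 3"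
proof -
  interpret digraph D
    by fact
  let ?O = "out_neighbors D"
  obtain f where f: "\<And>v. v \<in> verts D \<Longrightarrow> f v < dichromatic_number D"
    and acyc: "\<And>i. i < dichromatic_number D \<Longrightarrow> acyclic_digraph (D \<restriction> {v \<in> verts D. f v = i})"
    using acyclic_classes_if_acyclic_partition[OF acyclic_partition_dichromatic_number] by metis
  define X where "X i = {v \<in> verts D. f v = i}" for i
  define nxt :: "nat \<Rightarrow> nat" where "nxt i = (if i = 2 then 0 else i + 1)" for i
  have nxt: "nxt i < 3" "nxt i \<noteq> i" "nxt (nxt i) \<noteq> i" "nxt (nxt i) \<noteq> nxt i"
      "nxt (nxt (nxt i)) = i" if "i < 3" for i
  proof -
    from that have "i = 0 \<or> i = 1 \<or> i = 2"
      by auto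
    then show "nxt i < 3" "nxt i \<noteq> i" "nxt (nxt i) \<noteq> i" "nxt (nxt i) \<noteq> nxt i"
      "nxt (nxt (nxt i)) = i"
      by (auto simp: nxt_def)
  qed
  \<comment> \<open>The class that shares the first color of \<open>X i\<close> is the cyclic predecessor, which is reached
      by two steps forward; the second color is shared with the successor.\<close>
  define good where "good i c \<longleftrightarrow> (\<forall>v\<in>X i.
      c v = Suc i \<and>
        2 * card {w \<in> ?O v. w \<in> X i \<and> c w = Suc i \<or> w \<in> X (nxt (nxt i))} \<le> card (?O v) \<or>
      c v = Suc (nxt i) \<and>
        2 * card {w \<in> ?O v. w \<in> X i \<and> c w = Suc (nxt i) \<or> w \<in> X (nxt i)} \<le> card (?O v))" for i c
  have "\<exists>c. good i c"
    if "i < dichromatic_number D" for i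
  proof -
    have "i < 3"
      using that assms(2) by simp
    note n = nxt[OF this]
    show ?thesis
      unfolding good_def
    proof (rule robust_coloring_of_acyclic_set)
      show "acyclic_digraph (D \<restriction> X i)"
        using acyc[OF that] by (simp add: X_def)
    qed (use n in \<open>auto simp: X_def\<close>)
  qed
  then obtain g where "\<And>i. i < dichromatic_number D \<Longrightarrow> good i (g i)"
    by metis
  note g = this[unfolded good_def, THEN bspec]
  define c where "c v = g (f v) v" for v
  have f3: "f v < 3" if "v \<in> verts D" for v
    using f[OF that] assms(2) by simp
  have c_cases: "c v = Suc (f v) \<or> c v = Suc (nxt (f v))" if "v \<in> verts D" for v
    using g[OF f[OF that], of v] that unfolding c_def X_def by auto
  have "majority_coloring D 3 c"
    unfolding majority_coloring_def
  proof (intro conjI ballI)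
    show "c \<in> verts D \<rightarrow> {1..3}"
      using c_cases f3 nxt(1) by (fastforce simp: Suc_le_eq)
  next
    fix v
    assume v: "v \<in> verts D"
    let ?i = "f v"
    have same: "2 * card {w \<in> ?O v. c w = c v} \<le> card (?O v)"
      if "2 * card {w \<in> ?O v. w \<in> X ?i \<and> g ?i w = c v \<or> w \<in> Y} \<le> card (?O v)"
        and Y: "\<And>w. w \<in> verts D \<Longrightarrow> f w \<noteq> ?i \<Longrightarrow> c w = c v \<Longrightarrow> w \<in> Y" for Y
    proof -
      have "w \<in> verts D" if "w \<in> ?O v" for w
        using that by (auto simp: out_neighbors_def)
      then have "{w \<in> ?O v. c w = c v} \<subseteq> {w \<in> ?O v. w \<in> X ?i \<and> g ?i w = c v \<or> w \<in> Y}"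
        using Y unfolding X_def c_def by (auto; metis)
      then have "card {w \<in> ?O v. c w = c v}
          \<le> card {w \<in> ?O v. w \<in> X ?i \<and> g ?i w = c v \<or> w \<in> Y}"
        using finite_out_neighbors[of v] by (intro card_mono) auto
      with that(1) show ?thesis
        by simp
    qed
    have "v \<in> X ?i"
      using v by (simp add: X_def)
    from g[OF f[OF v] this] show "2 * card {w \<in> ?O v. c w = c v} \<le> card (?O v)"
    proof (elim disjE conjE)
      assume cv: "g ?i v = Suc ?i"
        and le: "2 * card {w \<in> ?O v. w \<in> X ?i \<and> g ?i w = Suc ?i \<or> w \<in> X (nxt (nxt ?i))}
          \<le> card (?O v)"
      show ?thesis
      proof (rule same[of "X (nxt (nxt ?i))"])
        fix w
        assume w: "w \<in> verts D" "f w \<noteq> ?i" "c w = c v"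
        then have "nxt (f w) = ?i"
          using c_cases[OF w(1)] cv by (auto simp: c_def)
        then show "w \<in> X (nxt (nxt ?i))"
          using w(1) nxt(5)[OF f3[OF w(1)]] by (simp add: X_def)
      qed (use le cv in \<open>simp add: c_def\<close>)
    next
      assume cv: "g ?i v = Suc (nxt ?i)"
        and le: "2 * card {w \<in> ?O v. w \<in> X ?i \<and> g ?i w = Suc (nxt ?i) \<or> w \<in> X (nxt ?i)}
          \<le> card (?O v)"
      show ?thesis
      proof (rule same[of "X (nxt ?i)"])
        fix w
        assume w: "w \<in> verts D" "f w \<noteq> ?i" "c w = c v"
        \<comment> \<open>\<open>nxt\<close> is injective on the three indices, so \<open>w\<close> cannot use its second color.\<close>
        then have "nxt (f w) \<noteq> nxt ?i"
          using nxt(5)[OF f3[OF v]] nxt(5)[OF f3[OF w(1)]] by metis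
        then have "f w = nxt ?i"
          using c_cases[OF w(1)] cv w(3) by (auto simp: c_def)
        then show "w \<in> X (nxt ?i)"
          using w(1) by (simp add: X_def)
      qed (use le cv in \<open>simp add: c_def\<close>)
    qed
  qed
  then show ?thesis
    unfolding majority_colorable_def by blast
qed

end
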